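(* Let $F$ be the free monoid on $\pi_1,\pi_2$ and let $T$ be the monoid of $F$-colored binary trees. An element $A\in T$ has a right inverse in $T$ if and only if $\deg A=1$. An element $B\in T$ has a left inverse in $T$ if and only if some leaf of $B$ has color $1$.
   Context: The monoid $T$: $T$ is the set of finite nonempty ordered binary trees (each non-leaf vertex has exactly one left child and one right child) whose leaves are colored by elements of $F$; equivalently, the free magma with basis $F$. $\Sigma(A,B)$ is the tree whose root has left subtree $A$ and right subtree $B$. $\deg A$ is the number of leaves of $A$. Elements of $F$ are identified with the one-vertex trees (the trees of degree $1$), and each $A\in T$ is either in $F$ or uniquely $A=\Sigma(A_1,A_2)$. $F$ acts on $T$ from the left: $\pi_i$ sends $w\in F$ to the word $\pi_iw$, and sends $\Sigma(A_1,A_2)$ to $A_i$; a word acts by applying its symbols one at a time from right to left. The product $AB$ is the tree obtained from $A$ by replacing each leaf of color $w\in F$ by $wB$. With this product $T$ is a monoid with identity $1\in F$. A right inverse of $A$ is a $C\in T$ with $AC=1$; a left inverse of $B$ is a $C\in T$ with $CB=1$. *)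

theory Defs
  imports Main
begin

datatype gen = Pi1 | Pi2

text \<open>
  The free monoid \<open>F\<close> is the type of words \<^typ>\<open>gen list\<close> under concatenation, with the
  leftmost symbol at the head of the list; its identity \<open>1\<close> is the empty word.
\<close>

type_synonym F = "gen list"

text \<open>A word \<open>w\<close> is identified with the one-vertex tree \<open>Leaf w\<close>.\<close>

datatype T = Leaf F | \<Sigma> T T

primrec deg :: "T \<Rightarrow> nat" where
  "deg (Leaf w) = 1"
| "deg (\<Sigma> A B) = deg A + deg B"

primrec leaf_colors :: "T \<Rightarrow> F set" where
  "leaf_colors (Leaf w) = {w}"
| "leaf_colors (\<Sigma> A B) = leaf_colors A \<union> leaf_colors B"

fun act_gen :: "gen \<Rightarrow> T \<Rightarrow> T" where
  "act_gen p (Leaf w) = Leaf (p # w)"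
| "act_gen Pi1 (\<Sigma> A B) = A"
| "act_gen Pi2 (\<Sigma> A B) = B"

text \<open>\<^const>\<open>foldr\<close> applies the last (rightmost) symbol of the word first.\<close>

definition act :: "F \<Rightarrow> T \<Rightarrow> T" where
  "act w A = foldr act_gen w A"

lemma act_Nil [simp]: "act [] A = A"
  by (simp add: act_def)

lemma act_Cons [simp]: "act (p # w) A = act_gen p (act w A)"
  by (simp add: act_def)

lemma act_append: "act (v @ w) A = act v (act w A)"
  by (simp add: act_def)

lemma act_Leaf: "act v (Leaf w) = Leaf (v @ w)"
  by (induction v) simp_all

instantiation T :: monoid_mult
begin

definition one_T :: T where
  "1 = Leaf []"

primrec times_T :: "T \<Rightarrow> T \<Rightarrow> T" where
  "Leaf w * B = act w B"
| "\<Sigma> A1 A2 * B = \<Sigma> (A1 * B) (A2 * B)"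

instance
proof
  have gen: "act_gen p A * B = act_gen p (A * B)" for p and A B :: T
    by (cases A; cases p) simp_all
  have act: "act w A * B = act w (A * B)" for w and A B :: T
    by (induction w) (simp_all add: gen)
  show "A * B * C = A * (B * C)" for A B C :: T
    by (induction A) (simp_all add: act)
  show "1 * A = A" for A :: T
    by (simp add: one_T_def)
  show "A * 1 = A" for A :: T
    by (induction A) (simp_all add: one_T_def act_Leaf)
qed

end

end

theory Submission imports Defs begin

text \<open>
  A product whose left factor is a node is again a node, whereas \<open>1\<close> is a leaf. So both questions
  concern equations \<open>Leaf w * B = 1\<close>, that is, \<open>act w B = 1\<close>. With \<open>w\<close> given and \<open>B\<close> unknown this is
  always solvable, since a word acts surjectively on \<^typ>\<open>T\<close> (\<open>act_surj\<close>). With \<open>B\<close>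
  given and \<open>w\<close> unknown, a word can either descend to a subtree or lengthen the color of a
  one-vertex tree; neither operation creates a leaf of color \<open>1\<close> (\<open>Nil_leaf_color_act\<close>), while the
  path to an existing leaf of color \<open>1\<close> is a word that solves the equation
  (\<open>ex_path_to_Nil_leaf\<close>).
\<close>

lemma deg_pos: "deg A > 0"
  by (induction A) simp_all

lemma deg_eq_1_iff: "deg A = 1 \<longleftrightarrow> (\<exists>w. A = Leaf w)"
proof (cases A)
  case (\<Sigma> A1 A2)
  then show ?thesis
    using deg_pos[of A1] deg_pos[of A2] by simp
qed simp

lemma times_eq_1_iff: "A * B = 1 \<longleftrightarrow> (\<exists>w. A = Leaf w \<and> act w B = 1)"
  by (cases A) (simp_all add: one_T_def)

text \<open>Each generator is surjective, because both subtrees of \<open>\<Sigma> D D\<close> are \<open>D\<close>.\<close>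

lemma act_surj: "\<exists>C. act w C = D"
proof (induction w arbitrary: D)
  case (Cons p w)
  obtain C where "act w C = \<Sigma> D D"
    using Cons.IH by blast
  then have "act (p # w) C = D"
    by (cases p) simp_all
  then show ?case ..
qed simp

lemma Nil_leaf_color_act_gen:
  "[] \<in> leaf_colors (act_gen p A) \<Longrightarrow> [] \<in> leaf_colors A"
  by (cases "(p, A)" rule: act_gen.cases) auto

lemma Nil_leaf_color_act:
  "[] \<in> leaf_colors (act w A) \<Longrightarrow> [] \<in> leaf_colors A"
  by (induction w) (auto dest: Nil_leaf_color_act_gen)

text \<open>
  The word spells the path from the root to the leaf. Its rightmost symbol acts first, so the
  step away from the root is appended at the end of the path inside the subtree.
\<close>

lemma ex_path_to_Nil_leaf:
  "[] \<in> leaf_colors B \<Longrightarrow> \<exists>w. act w B = 1"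
proof (induction B)
  case (Leaf v)
  then have "act [] (Leaf v) = 1"
    by (simp add: one_T_def)
  then show ?case ..
next
  case (\<Sigma> B1 B2)
  from \<Sigma>.prems consider "[] \<in> leaf_colors B1" | "[] \<in> leaf_colors B2"
    by auto
  then show ?case
  proof cases
    case 1
    then obtain w where "act w B1 = 1"
      using \<Sigma>.IH(1) by blast
    then have "act (w @ [Pi1]) (\<Sigma> B1 B2) = 1"
      by (simp add: act_append)
    then show ?thesis ..
  next
    case 2
    then obtain w where "act w B2 = 1"
      using \<Sigma>.IH(2) by blast
    then have "act (w @ [Pi2]) (\<Sigma> B1 B2) = 1"
      by (simp add: act_append)
    then show ?thesis ..
  qed
qed

lemma ex_act_eq_1_iff: "(\<exists>w. act w B = 1) \<longleftrightarrow> [] \<in> leaf_colors B"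
proof
  assume "\<exists>w. act w B = 1"
  then obtain w where "act w B = Leaf []"
    by (auto simp: one_T_def)
  then have "[] \<in> leaf_colors (act w B)"
    by simp
  then show "[] \<in> leaf_colors B"
    by (rule Nil_leaf_color_act)
qed (rule ex_path_to_Nil_leaf)

theorem proposition5:
  "(\<forall>A::T. (\<exists>C::T. A * C = 1) \<longleftrightarrow> deg A = 1) \<and>
   (\<forall>B::T. (\<exists>C::T. C * B = 1) \<longleftrightarrow> [] \<in> leaf_colors B)"
proof (intro conjI allI)
  fix A :: T
  show "(\<exists>C. A * C = 1) \<longleftrightarrow> deg A = 1"
    unfolding times_eq_1_iff deg_eq_1_iff using act_surj by blast
next
  fix B :: T
  show "(\<exists>C. C * B = 1) \<longleftrightarrow> [] \<in> leaf_colors B"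
    unfolding times_eq_1_iff ex_act_eq_1_iff[symmetric] by blast
qed

end
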